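(* Let $n>1$ be an integer, let $\omega=e^{2\pi i/n}$, and let $\varepsilon>0$ be a real number. Then there exists $X\in\mathbb{C}$ such that $\{\operatorname{Re}(X\omega^k)\}\in(\varepsilon,1-\varepsilon)$ for all integers $k$ with $1\le k\le n$ if and only if (1) $\varepsilon<\frac{p-1}{2p}$, in the case when $n$ is not a power of $2$ and $p$ is the smallest odd prime dividing $n$; (2) $\varepsilon<\frac12$, otherwise (i.e. when $n$ is a power of $2$).
   Context: For a real number $x$, $\{x\}=x-\lfloor x\rfloor\in[0,1)$ denotes the fractional part of $x$. The interval $(\varepsilon,1-\varepsilon)$ is empty when $\varepsilon\ge 1/2$. *)

theory Defs
  imports "HOL-Analysis.Analysis" "HOL-Computational_Algebra.Primes"
begin

end

theory Submission
  imports Defs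
begin

text \<open>
  Let \<open>p\<close> be an odd prime dividing \<open>n\<close>. The numbers \<open>Re (X \<omega>\<^sup>k)\<close> sum to \<open>0\<close> over a coset of the
  subgroup of order \<open>p\<close>, so their fractional parts sum to an integer, which cannot happen if all of
  them lie strictly within \<open>1 / (2 p)\<close> of \<open>1 / 2\<close>; this gives the upper bound on \<open>\<epsilon>\<close>.

  Conversely, the powers \<open>\<omega>\<^sup>k\<close> for which no top digit of \<open>k\<close> at a prime dividing \<open>n\<close> vanishes
  are independent over the integers, and the coset relations express all other powers through
  them. For a generic direction \<open>Y\<close>, Kronecker's theorem therefore makes \<open>Re (t Y \<omega>\<^sup>k)\<close> approximate
  modulo \<open>1\<close> any \<open>f\<close> whose coset sums are integers. It remains to choose such an \<open>f\<close> with values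
  \<open>1 / 2 \<plusminus> 1 / (2 p)\<close> for the least odd prime divisor \<open>p\<close>, or \<open>f = 1 / 2\<close> for a power of \<open>2\<close>. The signs
  are products, over the primes \<open>q\<close> dividing \<open>n\<close>, of functions of the top digit at \<open>q\<close> whose sum
  is \<open>p\<close> for odd \<open>q\<close> and \<open>0\<close> for \<open>q = 2\<close>.
\<close>

section \<open>Integer relations between roots of unity\<close>

text \<open>The values at \<open>\<omega>\<close> are the elements of the ring Z[\<omega>], so an
  integer relation between powers of \<open>\<omega>\<close> is a polynomial that vanishes
  there.\<close>

definition int_poly_eval :: "int poly \<Rightarrow> 'a::comm_ring_1 \<Rightarrow> 'a"
  where "int_poly_eval g x = poly (map_poly of_int g) x"

lemma int_poly_eval_0 [simp]: "int_poly_eval 0 x = 0"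
  by (simp add: int_poly_eval_def)

lemma int_poly_eval_pCons [simp]:
  "int_poly_eval (pCons a g) x = of_int a + x * int_poly_eval g x"
  by (simp add: int_poly_eval_def map_poly_pCons)

lemma int_poly_eval_add [simp]:
  "int_poly_eval (g + h) x = int_poly_eval g x + int_poly_eval h x"
  by (induction g h rule: poly_induct2) (simp_all add: algebra_simps)

lemma int_poly_eval_smult [simp]: "int_poly_eval (smult a g) x = of_int a * int_poly_eval g x"
  by (induction g) (simp_all add: algebra_simps)

lemma int_poly_eval_minus [simp]: "int_poly_eval (- g) x = - int_poly_eval g x"
  using int_poly_eval_smult [of "-1" g x] by simp

lemma int_poly_eval_diff [simp]:
  "int_poly_eval (g - h) x = int_poly_eval g x - int_poly_eval h x"
  using int_poly_eval_add [of g "- h" x] by simp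

lemma int_poly_eval_mult [simp]:
  "int_poly_eval (g * h) x = int_poly_eval g x * int_poly_eval h x"
  by (induction g) (simp_all add: algebra_simps)

lemma int_poly_eval_1 [simp]: "int_poly_eval 1 x = 1"
  by (simp add: one_pCons)

lemma int_poly_eval_power [simp]: "int_poly_eval (g ^ m) x = int_poly_eval g x ^ m"
  by (induction m) simp_all

lemma int_poly_eval_of_nat [simp]: "int_poly_eval (of_nat m) x = of_nat m"
  by (induction m) simp_all

lemma int_poly_eval_sum [simp]: "int_poly_eval (sum g A) x = (\<Sum>i\<in>A. int_poly_eval (g i) x)"
  by (induction A rule: infinite_finite_induct) simp_all

lemma int_poly_eval_monom [simp]: "int_poly_eval (monom a m) x = of_int a * x ^ m"
  by (induction m) (simp_all add: monom_0 monom_Suc)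

lemma int_poly_eval_pcompose [simp]:
  "int_poly_eval (pcompose g h) x = int_poly_eval g (int_poly_eval h x)"
  by (induction g) (simp_all add: pcompose_pCons)

section \<open>Frobenius congruences modulo a prime\<close>

lemma prime_dvd_binomial_power_diff:
  fixes a b :: "'a::comm_ring_1"
  assumes "prime q"
  shows "of_nat q dvd (a + b) ^ q - a ^ q - b ^ q"
proof -
  let ?t = "\<lambda>k. of_nat (q choose k) * a ^ k * b ^ (q - k)"
  have q: "q > 0" using assms by (simp add: prime_gt_0_nat)
  have "{..q} = insert 0 (insert q {0<..<q})" using q by auto
  then have "(a + b) ^ q = b ^ q + (a ^ q + (\<Sum>k\<in>{0<..<q}. ?t k))"
    unfolding binomial_ring using q by simp
  moreover have "of_nat q dvd (\<Sum>k\<in>{0<..<q}. ?t k)"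
  proof (rule dvd_sum)
    fix k assume "k \<in> {0<..<q}"
    then have "q dvd (q choose k)"
      using assms by (intro dvd_choose_prime) auto
    then show "of_nat q dvd ?t k"
      by (metis dvd_mult2 of_nat_dvd_iff of_nat_mult dvd_def)
  qed
  ultimately show ?thesis by simp
qed

lemma prime_dvd_power_diff_int:
  assumes "prime q"
  shows "int q dvd a ^ q - a"
proof (induction a rule: int_induct [where k = 0])
  case base
  then show ?case using assms by (simp add: power_0_left prime_gt_0_nat)
next
  case (step1 i)
  have "(i + 1) ^ q - (i + 1) = ((i + 1) ^ q - i ^ q - 1 ^ q) + (i ^ q - i)" by simp
  then show ?case
    using prime_dvd_binomial_power_diff [OF assms, of i 1] step1 by (metis dvd_add of_nat_id)
next
  case (step2 i)
  have "(i - 1) ^ q - (i - 1) = (i ^ q - i) - ((i - 1 + 1) ^ q - (i - 1) ^ q - 1 ^ q)" by simp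
  then show ?case
    using prime_dvd_binomial_power_diff [OF assms, of "i - 1" 1] step2 by (metis dvd_diff)
qed

text \<open>Induction on \<open>g\<close>: modulo \<open>q\<close>, taking \<open>q\<close>-th
  powers is additive, and by Fermat it fixes the constant coefficient split off at each
  step.\<close>

lemma prime_dvd_frobenius_diff:
  fixes g :: "int poly"
  assumes q: "prime q"
  shows "of_nat q dvd pcompose g (monom 1 q) - g ^ q"
proof (induction g)
  case 0
  then show ?case using q by (simp add: power_0_left prime_gt_0_nat)
next
  case (pCons a g)
  let ?X = "monom 1 1 :: int poly"
  have split: "pCons a g = [:a:] + ?X * g"
    by (simp add: monom_Suc monom_0)
  have X: "?X ^ q = monom 1 q" by (simp add: monom_power)
  have "of_nat q dvd [:a ^ q - a:]"
    using prime_dvd_power_diff_int [OF q, of a] by (simp add: of_nat_poly const_poly_dvd_const_poly_iff)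
  then have 1: "of_nat q dvd [:a:] ^ q - [:a:]"
    by (simp add: poly_const_pow)
  have 2: "of_nat q dvd monom 1 q * (pcompose g (monom 1 q) - g ^ q)"
    using pCons.IH by simp
  have 3: "of_nat q dvd ([:a:] + ?X * g) ^ q - [:a:] ^ q - (?X * g) ^ q"
    by (rule prime_dvd_binomial_power_diff [OF q])
  have "pcompose (pCons a g) (monom 1 q) - (pCons a g) ^ q
     = monom 1 q * (pcompose g (monom 1 q) - g ^ q) - ([:a:] ^ q - [:a:])
       - (([:a:] + ?X * g) ^ q - [:a:] ^ q - (?X * g) ^ q)"
    unfolding pcompose_pCons power_mult_distrib X split [symmetric] by (simp add: algebra_simps)
  then show ?case using 1 2 3 by (metis dvd_diff)
qed

section \<open>Divisibility in Z[\<omega>] and Galois conjugation\<close>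

locale primitive_root_of_unity =
  fixes n :: nat and \<omega> :: complex
  assumes n_gt_1: "n > 1"
    and root_power_eq_1_iff: "\<omega> ^ k = 1 \<longleftrightarrow> n dvd k"
begin

lemma root_nonzero: "\<omega> \<noteq> 0"
  using root_power_eq_1_iff [of n] n_gt_1 by (auto simp: power_0_left)

lemma root_power_mod: "\<omega> ^ (k mod n) = \<omega> ^ k"
proof -
  have "\<omega> ^ k = \<omega> ^ (n * (k div n) + k mod n)" by simp
  also have "\<dots> = \<omega> ^ (k mod n)"
    unfolding power_add using root_power_eq_1_iff [of "n * (k div n)"] by simp
  finally show ?thesis by simp
qed

text \<open>Pseudo-division by a nonzero integer polynomial \<open>f\<close> of least degree
  vanishing at \<open>\<omega>\<close> gives every element, up to a power of the leading coefficient
  \<open>l\<close>, a representative of degree below that of \<open>f\<close>. Such a representative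
  is unique, so divisibility by \<open>q\<close> can be read off its coefficients.\<close>

lemma prime_multiple_bounded:
  assumes "int_poly_eval g \<omega> \<noteq> 0"
  shows "\<exists>A. \<forall>q>A. prime q \<longrightarrow> (\<forall>h. int_poly_eval g \<omega> \<noteq> of_nat q * int_poly_eval h \<omega>)"
proof -
  define P where "P d \<longleftrightarrow> (\<exists>f. f \<noteq> 0 \<and> degree f = d \<and> int_poly_eval f \<omega> = 0)" for d
  have "P n"
    unfolding P_def
  proof (intro exI conjI)
    show d: "degree (monom 1 n - 1 :: int poly) = n"
      using n_gt_1 degree_add_eq_right [of "- 1 :: int poly" "monom 1 n"]
      by (simp add: degree_monom_eq)
    show "monom 1 n - 1 \<noteq> (0 :: int poly)" using d n_gt_1 by auto
    show "int_poly_eval (monom 1 n - 1) \<omega> = 0"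
      using root_power_eq_1_iff [of n] by simp
  qed
  then obtain f where f: "f \<noteq> 0" "degree f = (LEAST d. P d)" "int_poly_eval f \<omega> = 0"
    using LeastI [of P n] P_def by blast
  define l where "l = lead_coeff f"
  have min: "r = 0" if "int_poly_eval r \<omega> = 0" "r = 0 \<or> degree r < degree f" for r
    using that f(2) not_less_Least [of "degree r" P] P_def by auto
  have reduce: "\<exists>k r. (r = 0 \<or> degree r < degree f) \<and>
      int_poly_eval r \<omega> = of_int (l ^ k) * int_poly_eval h \<omega>" for h
  proof -
    obtain u r where ur: "pseudo_divmod h f = (u, r)" by force
    from pseudo_divmod [OF f(1) ur]
    have "smult (l ^ (Suc (degree h) - degree f)) h = f * u + r" "r = 0 \<or> degree r < degree f"
      by (auto simp: l_def)
    then show ?thesis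
      using f(3) arg_cong [of _ _ "\<lambda>p. int_poly_eval p \<omega>"]
      by (metis add_0 int_poly_eval_add int_poly_eval_mult int_poly_eval_smult mult_zero_left)
  qed
  have l0: "l \<noteq> 0" using f(1) by (simp add: l_def)
  obtain k r where r: "r = 0 \<or> degree r < degree f"
    and kr: "int_poly_eval r \<omega> = of_int (l ^ k) * int_poly_eval g \<omega>"
    using reduce by blast
  have r0: "r \<noteq> 0" using kr assms l0 by auto
  \<comment> \<open>A prime above this bound divides neither \<open>l\<close> nor the leading
    coefficient of \<open>r\<close>, as both are nonzero.\<close>
  define A where "A = nat (max \<bar>l\<bar> \<bar>lead_coeff r\<bar>)"
  have "int_poly_eval g \<omega> \<noteq> of_nat q * int_poly_eval h \<omega>" if q: "q > A" "prime q" for q h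
  proof
    assume eq: "int_poly_eval g \<omega> = of_nat q * int_poly_eval h \<omega>"
    obtain m s where s: "s = 0 \<or> degree s < degree f"
      and ms: "int_poly_eval s \<omega> = of_int (l ^ m) * int_poly_eval h \<omega>"
      using reduce by blast
    \<comment> \<open>Clearing the powers of \<open>l\<close> on both sides gives two
      representatives of the same element; by minimality of \<open>f\<close> they coincide.\<close>
    let ?d = "smult (l ^ m) r - smult (int q * l ^ k) s"
    have "?d = 0"
    proof (rule min)
      show "int_poly_eval ?d \<omega> = 0" by (simp add: kr ms eq)
      show "?d = 0 \<or> degree ?d < degree f"
      proof (cases "r = 0 \<or> s = 0")
        case True
        then show ?thesis using r s r0 by auto
      next
        case False
        then show ?thesis
          using r s by (intro disjI2 degree_diff_less) (auto intro: le_less_trans [OF degree_smult_le])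
      qed
    qed
    then have "l ^ m * lead_coeff r = int q * l ^ k * coeff s (degree r)"
      by (metis coeff_smult eq_iff_diff_eq_0)
    then have "int q dvd l ^ m * lead_coeff r" by simp
    moreover have "prime (int q)" using q by simp
    moreover have "\<not> int q dvd x" if "x \<noteq> 0" "\<bar>x\<bar> \<le> max \<bar>l\<bar> \<bar>lead_coeff r\<bar>" for x
      using dvd_imp_le_int [OF that(1), of "int q"] that(2) q(1) A_def by linarith
    ultimately show False
      using l0 r0 by (metis leading_coeff_0_iff max.cobounded1 max.cobounded2 prime_dvd_mult_iff prime_dvd_power)
  qed
  then show ?thesis by blast
qed

text \<open>
  Landau's argument: modulo a prime \<open>q\<close>, \<open>g (\<omega>\<^sup>q\<^sup>m)\<close> equals \<open>g (\<omega>\<^sup>m)\<^sup>q\<close>, so if \<open>\<omega>\<^sup>m\<close> is a root of \<open>g\<close>, then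
  \<open>g (\<omega>\<^sup>q\<^sup>m)\<close> is divisible by \<open>q\<close>. As it takes only finitely many values, it vanishes for all large
  \<open>q\<close>; and \<open>a\<close> is congruent modulo \<open>n\<close> to a number all of whose prime factors are large.
\<close>
lemma int_poly_eval_conjugate:
  assumes g: "int_poly_eval g \<omega> = 0" and a: "coprime a n"
  shows "int_poly_eval g (\<omega> ^ a) = 0"
proof -
  have ex: "\<exists>A. int_poly_eval g (\<omega> ^ k) \<noteq> 0 \<longrightarrow>
      (\<forall>q>A. prime q \<longrightarrow> (\<forall>h. int_poly_eval g (\<omega> ^ k) \<noteq> of_nat q * int_poly_eval h \<omega>))" for k
    using prime_multiple_bounded [of "pcompose g (monom 1 k)"] by simp
  then obtain A where A: "\<And>k q h. \<lbrakk>int_poly_eval g (\<omega> ^ k) \<noteq> 0; q > A k; prime q\<rbrakk> \<Longrightarrow>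
      int_poly_eval g (\<omega> ^ k) \<noteq> of_nat q * int_poly_eval h \<omega>"
    by metis
  \<comment> \<open>Powers of \<open>\<omega>\<close> depend only on the exponent modulo
    \<open>n\<close>, so finitely many bounds have to be beaten.\<close>
  define N where "N = Max (A ` {..<n})"
  have N: "A (k mod n) \<le> N" for k
    unfolding N_def using n_gt_1 by (intro Max_ge) auto
  have step: "int_poly_eval g (\<omega> ^ (q * m)) = 0"
    if m: "int_poly_eval g (\<omega> ^ m) = 0" and q: "prime q" "q > N" for q m
  proof (rule ccontr)
    assume nz: "int_poly_eval g (\<omega> ^ (q * m)) \<noteq> 0"
    obtain h where h: "pcompose g (monom 1 q) - g ^ q = of_nat q * h"
      using prime_dvd_frobenius_diff [OF q(1), of g] by (auto simp: dvd_def)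
    have "int_poly_eval g ((\<omega> ^ m) ^ q) = of_nat q * int_poly_eval h (\<omega> ^ m)"
      using arg_cong [OF h, of "\<lambda>p. int_poly_eval p (\<omega> ^ m)"] m q
      by (simp add: power_0_left prime_gt_0_nat)
    also have "\<dots> = of_nat q * int_poly_eval (pcompose h (monom 1 m)) \<omega>" by simp
    finally have "int_poly_eval g (\<omega> ^ (q * m mod n))
        = of_nat q * int_poly_eval (pcompose h (monom 1 m)) \<omega>"
      by (simp add: root_power_mod power_mult [symmetric] mult.commute)
    then show False
      using A [of "q * m mod n" q "pcompose h (monom 1 m)"] nz q N [of "q * m"] by (simp add: root_power_mod)
  qed
  have large: "int_poly_eval g (\<omega> ^ m) = 0" if "m > 0" "\<And>q. prime q \<Longrightarrow> q dvd m \<Longrightarrow> q > N" for m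
    using that
  proof (induction m rule: prime_divisors_induct)
    case (factor q m)
    then show ?case using step [of m q] by (auto)
  qed (use g in auto)
  \<comment> \<open>Each prime up to \<open>N\<close> divides exactly one of the two summands: if it
    divides \<open>a\<close>, it divides neither \<open>n\<close> nor the product; otherwise it is a
    factor of the product. Hence none divides \<open>M\<close>.\<close>
  define M where "M = a + n * \<Prod>{r. prime r \<and> r \<le> N \<and> \<not> r dvd a}"
  have fin: "finite {r. prime r \<and> r \<le> N \<and> \<not> r dvd a}"
    by (rule finite_subset [of _ "{..N}"]) auto
  have "q > N" if q: "prime q" "q dvd M" for q
  proof (rule ccontr)
    assume "\<not> N < q"
    show False
    proof (cases "q dvd a")
      case True
      then have "q dvd n * \<Prod>{r. prime r \<and> r \<le> N \<and> \<not> r dvd a}"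
        using q(2) by (simp add: M_def dvd_add_right_iff)
      moreover have "\<not> q dvd n"
        using True a q(1) by (meson coprime_common_divisor not_prime_unit)
      ultimately obtain r where "r \<in> {r. prime r \<and> r \<le> N \<and> \<not> r dvd a}" "q dvd r"
        using q(1) fin by (auto simp: prime_dvd_mult_iff prime_dvd_prod_iff)
      then show False using True q(1) primes_dvd_imp_eq by blast
    next
      case False
      then have "q dvd \<Prod>{r. prime r \<and> r \<le> N \<and> \<not> r dvd a}"
        using q(1) \<open>\<not> N < q\<close> fin by (intro dvd_prodI) auto
      then have "q dvd a" using q(2) by (simp add: M_def dvd_add_left_iff)
      with False show False by simp
    qed
  qed
  moreover have "M > 0"
    unfolding M_def using fin n_gt_1 by (auto intro!: prod_pos simp: prime_gt_0_nat)
  ultimately have "int_poly_eval g (\<omega> ^ M) = 0" using large by blast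
  moreover have "\<omega> ^ M = \<omega> ^ a"
    using root_power_mod [of M] root_power_mod [of a] by (simp add: M_def)
  ultimately show ?thesis by simp
qed

end

section \<open>An integral basis of powers\<close>

text \<open>For \<open>n\<close>-periodic \<open>F\<close> this multiplies the Fourier coefficient
  at \<open>a\<close> by 1 - \<omega>^(-a s). With \<open>s = n div q\<close> the factor is zero
  exactly when \<open>q\<close> divides \<open>a\<close>.\<close>

definition shift_diff :: "nat \<Rightarrow> (nat \<Rightarrow> complex) \<Rightarrow> nat \<Rightarrow> complex"
  where "shift_diff s F k = F k - F (k + s)"

section \<open>Top digits along cosets\<close>

text \<open>The top base-\<open>q\<close> digit of the residue of \<open>k\<close> modulo the largest power of \<open>q\<close> dividing \<open>n\<close>.\<close>
definition digit :: "nat \<Rightarrow> nat \<Rightarrow> nat \<Rightarrow> nat"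
  where "digit n q k = (k div q ^ (multiplicity q n - 1)) mod q"

text \<open>With b the multiplicity of \<open>q\<close> in \<open>n\<close>, \<open>n div q\<close>
  is q^(b-1) times a number \<open>m\<close> prime to \<open>q\<close>. Adding it leaves the lower
  digits alone and rotates the top digit by \<open>m\<close>.\<close>

lemma digit_coset:
  assumes "n > 0" "prime q" "q dvd n"
  obtains m where "coprime m q" "\<And>k j. digit n q (k + j * (n div q)) = (digit n q k + j * m) mod q"
proof -
  let ?b = "multiplicity q n"
  have q: "q > 0" using assms by (simp add: prime_gt_0_nat)
  obtain m where m: "n = q ^ ?b * m" "\<not> q dvd m"
    using multiplicity_decompose' [of n q] assms by (metis gr_implies_not0 not_prime_unit)
  have b: "?b = Suc (?b - 1)"
    using assms prime_multiplicity_gt_zero_iff [of q n] by simp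
  then have "n = q * (q ^ (?b - 1) * m)"
    by (metis m(1) mult.assoc power_Suc)
  then have nq: "n div q = q ^ (?b - 1) * m"
    by (metis q nonzero_mult_div_cancel_left not_gr_zero)
  show thesis
  proof
    show "coprime m q"
      using prime_imp_coprime [OF assms(2) m(2)] by (simp only: coprime_commute)
    fix k j
    have "(k + j * (n div q)) div q ^ (?b - 1) = (k + q ^ (?b - 1) * (j * m)) div q ^ (?b - 1)"
      by (simp add: nq mult_ac)
    also have "\<dots> = k div q ^ (?b - 1) + j * m"
      using q by simp
    finally show "digit n q (k + j * (n div q)) = (digit n q k + j * m) mod q"
      by (simp add: digit_def mod_add_left_eq)
  qed
qed

lemma digit_bij_betw_coset:
  assumes "n > 0" "prime q" "q dvd n"
  shows "bij_betw (\<lambda>j. digit n q (k + j * (n div q))) {..<q} {..<q}"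
proof -
  obtain m where m: "coprime m q"
    "\<And>k j. digit n q (k + j * (n div q)) = (digit n q k + j * m) mod q"
    using digit_coset [OF assms] by metis
  have q: "q > 0" using assms by (simp add: prime_gt_0_nat)
  have "inj_on (\<lambda>j. digit n q (k + j * (n div q))) {..<q}"
  proof (rule linorder_inj_onI')
    fix i j assume ij: "i \<in> {..<q}" "j \<in> {..<q}" "i < j"
    show "digit n q (k + i * (n div q)) \<noteq> digit n q (k + j * (n div q))"
    proof
      assume "digit n q (k + i * (n div q)) = digit n q (k + j * (n div q))"
      then have "q dvd (digit n q k + j * m) - (digit n q k + i * m)"
        unfolding m(2) using ij by (subst (asm) eq_commute, subst (asm) mod_eq_dvd_iff_nat) auto
      then have "q dvd (j - i) * m" by (simp add: diff_mult_distrib)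
      then have "q dvd j - i" using m(1) by (simp add: coprime_dvd_mult_left_iff coprime_commute)
      then show False using ij by (auto dest: dvd_imp_le)
    qed
  qed
  moreover have "(\<lambda>j. digit n q (k + j * (n div q))) ` {..<q} \<subseteq> {..<q}"
    using q by (auto simp: digit_def)
  ultimately show ?thesis
    by (simp add: bij_betw_def endo_inj_surj)
qed

text \<open>For a prime \<open>r\<close> other than \<open>q\<close>, the full power of
  \<open>q\<close> in \<open>n\<close> still divides \<open>n div r\<close>.\<close>

lemma digit_other_coset:
  assumes "n > 0" "prime q" "q dvd n" "prime r" "r dvd n" "q \<noteq> r"
  shows "digit n q (k + j * (n div r)) = digit n q k"
proof -
  let ?b = "multiplicity q n"
  have q: "q > 0" using assms by (simp add: prime_gt_0_nat)
  have b: "?b = Suc (?b - 1)"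
    using assms prime_multiplicity_gt_zero_iff [of q n] by simp
  have "q ^ ?b dvd r * (n div r)"
    using assms by (simp add: multiplicity_dvd)
  moreover have "coprime (q ^ ?b) r"
    using assms by (simp add: primes_coprime)
  ultimately have "q ^ ?b dvd n div r"
    by (simp add: coprime_dvd_mult_right_iff)
  then obtain m where m: "n div r = q ^ ?b * m" by (auto simp: dvd_def)
  then have "n div r = q ^ (?b - 1) * (q * m)"
    by (metis b mult.assoc mult.commute power_Suc)
  then have "(k + j * (n div r)) div q ^ (?b - 1) = (k + q ^ (?b - 1) * (j * (q * m))) div q ^ (?b - 1)"
    by (simp add: mult_ac)
  also have "\<dots> = k div q ^ (?b - 1) + q * (j * m)"
    using q by simp
  finally show ?thesis by (simp add: digit_def)
qed

lemma digit_mod: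
  assumes "n > 0" "prime q" "q dvd n"
  shows "digit n q (k mod n) = digit n q k"
proof -
  obtain m where m: "\<And>k j. digit n q (k + j * (n div q)) = (digit n q k + j * m) mod q"
    using digit_coset [OF assms] by metis
  have "k = k mod n + (k div n * q) * (n div q)"
    using assms by (simp add: mult.assoc)
  then have "digit n q k = (digit n q (k mod n) + (k div n * q) * m) mod q"
    using m by metis
  also have "\<dots> = digit n q (k mod n)"
    by (simp add: mult.assoc mult.left_commute [of _ q] digit_def)
  finally show ?thesis by simp
qed

lemma foldr_shift_diff_vanish:
  assumes n: "n > 0" and q: "prime q" "q dvd n" and F: "\<And>k. digit n q k = 0 \<Longrightarrow> F k = 0"
    and qs: "\<And>r. r \<in> set qs \<Longrightarrow> prime r \<and> r dvd n" "q \<notin> set qs" and k: "digit n q k = 0"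
  shows "foldr (\<lambda>r. shift_diff (n div r)) qs F k = 0"
  using qs k
proof (induction qs arbitrary: k)
  case Nil
  then show ?case by (simp add: F)
next
  case (Cons r qs)
  have "digit n q (k + n div r) = 0"
    using digit_other_coset [OF n q, of r k 1] Cons.prems by auto
  then show ?case using Cons by (simp add: shift_diff_def)
qed

text \<open>The differences are peeled off from the outside. If the one for \<open>q\<close>
  vanishes, the inner function \<open>G\<close> is constant along steps of \<open>n div q\<close>;
  every such coset has a point with top digit 0 at \<open>q\<close>, where \<open>G\<close> vanishes
  because the remaining shifts preserve that digit.\<close>

lemma foldr_shift_diff_injective:
  assumes n: "n > 0" and "distinct qs" and "\<And>q. q \<in> set qs \<Longrightarrow> prime q \<and> q dvd n"
    and "\<And>k q. q \<in> set qs \<Longrightarrow> digit n q k = 0 \<Longrightarrow> F k = 0"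
    and "\<And>k. foldr (\<lambda>r. shift_diff (n div r)) qs F k = 0"
  shows "F k = 0"
  using assms(2-)
proof (induction qs)
  case Nil
  then show ?case by simp
next
  case (Cons q qs)
  define G where "G = foldr (\<lambda>r. shift_diff (n div r)) qs F"
  have q: "prime q" "q dvd n" using Cons.prems by auto
  have "shift_diff (n div q) G k = 0" for k
    using Cons.prems(4) [of k] by (simp add: G_def)
  then have "G k = G (k + n div q)" for k
    by (simp add: shift_diff_def)
  then have per: "G (k + j * (n div q)) = G k" for k j
    by (induction j) (use \<open>\<And>k. G k = G (k + n div q)\<close> [symmetric] in
        \<open>simp_all add: add.commute [of "n div q"] flip: add.assoc\<close>)
  have "G k = 0" for k
  proof -
    have "0 \<in> (\<lambda>j. digit n q (k + j * (n div q))) ` {..<q}"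
      using digit_bij_betw_coset [OF n q] q(1) by (simp add: bij_betw_def prime_gt_0_nat)
    then obtain j where "digit n q (k + j * (n div q)) = 0" by auto
    then have "G (k + j * (n div q)) = 0"
      unfolding G_def using Cons.prems n q by (intro foldr_shift_diff_vanish) auto
    then show ?thesis by (simp add: per)
  qed
  then show ?case
    unfolding G_def using Cons.prems by (intro Cons.IH) auto
qed

section \<open>Fourier transform modulo \<open>n\<close> and independence\<close>

context primitive_root_of_unity
begin

definition fourier :: "(nat \<Rightarrow> complex) \<Rightarrow> nat \<Rightarrow> complex"
  where "fourier F a = (\<Sum>k<n. F k * \<omega> ^ (a * k))"

lemma sum_periodic_shift:
  fixes H :: "nat \<Rightarrow> complex"
  assumes "\<And>k. H (k + n) = H k"
  shows "(\<Sum>k<n. H (k + s)) = (\<Sum>k<n. H k)"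
proof (induction s)
  case (Suc s)
  have "(\<Sum>k<n. H (k + Suc s)) + H s = (\<Sum>k<Suc n. H (k + s))"
    by (subst sum.lessThan_Suc_shift) simp
  also have "\<dots> = (\<Sum>k<n. H (k + s)) + H s"
    using assms [of s] by (simp add: add.commute)
  finally show ?case using Suc by simp
qed simp

lemma fourier_shift:
  assumes "\<And>k. F (k + n) = F k"
  shows "\<omega> ^ (a * s) * fourier (\<lambda>k. F (k + s)) a = fourier F a"
proof -
  have "\<omega> ^ (a * n) = 1" by (simp add: root_power_eq_1_iff)
  then have "(\<Sum>k<n. F (k + s) * \<omega> ^ (a * (k + s))) = fourier F a"
    unfolding fourier_def
    by (intro sum_periodic_shift) (simp add: assms power_add distrib_left)
  then show ?thesis
    by (simp add: fourier_def sum_distrib_left power_add distrib_left mult_ac)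
qed

lemma fourier_shift_diff:
  "fourier (shift_diff s F) a = fourier F a - fourier (\<lambda>k. F (k + s)) a"
  by (simp add: fourier_def shift_diff_def left_diff_distrib sum_subtractf)

lemma foldr_shift_diff_periodic:
  assumes "\<And>k. F (k + n) = F k"
  shows "foldr (\<lambda>r. shift_diff (n div r)) qs F (k + n) = foldr (\<lambda>r. shift_diff (n div r)) qs F k"
proof (induction qs arbitrary: k)
  case (Cons q qs)
  then have "foldr (\<lambda>r. shift_diff (n div r)) qs F (k + n div q + n)
      = foldr (\<lambda>r. shift_diff (n div r)) qs F (k + n div q)"
    by blast
  then show ?case by (simp add: shift_diff_def [of "n div q"] Cons add.assoc add.commute [of n])
qed (simp add: assms)

text \<open>When \<open>q\<close> divides \<open>a\<close>, a shift by \<open>n div q\<close> does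
  not change the transform at \<open>a\<close>, so the difference is zero there. The other
  differences only rescale the value, hence keep it zero.\<close>

lemma fourier_foldr_shift_diff:
  assumes F: "\<And>k. F (k + n) = F k" and qs: "\<And>q. q \<in> set qs \<Longrightarrow> q dvd n"
    and "fourier F a = 0 \<or> (\<exists>q\<in>set qs. q dvd a)"
  shows "fourier (foldr (\<lambda>r. shift_diff (n div r)) qs F) a = 0"
  using qs assms(3)
proof (induction qs)
  case Nil
  then show ?case by simp
next
  case (Cons q qs)
  define G where "G = foldr (\<lambda>r. shift_diff (n div r)) qs F"
  have shift: "\<omega> ^ (a * (n div q)) * fourier (\<lambda>k. G (k + n div q)) a = fourier G a"
    unfolding G_def by (intro fourier_shift foldr_shift_diff_periodic F)
  show ?case
  proof (cases "q dvd a")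
    case True
    then have "n dvd a * (n div q)"
      using Cons.prems(1) [of q] by (auto simp: dvd_def)
    then have "\<omega> ^ (a * (n div q)) = 1" by (simp add: root_power_eq_1_iff)
    then show ?thesis using shift by (simp add: fourier_shift_diff G_def)
  next
    case False
    then have "fourier G a = 0" using Cons by (auto simp: G_def)
    then show ?thesis using shift root_nonzero by (simp add: fourier_shift_diff G_def)
  qed
qed

lemma root_power_inj: "inj_on (\<lambda>k. \<omega> ^ k) {..<n}"
proof (rule linorder_inj_onI')
  fix i j assume ij: "i \<in> {..<n}" "j \<in> {..<n}" "i < j"
  have "\<omega> ^ j = \<omega> ^ i * \<omega> ^ (j - i)" using ij by (simp flip: power_add)
  moreover have "\<omega> ^ (j - i) \<noteq> 1" using ij by (auto simp: root_power_eq_1_iff dest: dvd_imp_le)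
  ultimately show "\<omega> ^ i \<noteq> \<omega> ^ j" using root_nonzero by auto
qed

text \<open>The transform lists values of a polynomial of degree below \<open>n\<close> at the
  \<open>n\<close> distinct powers of \<open>\<omega>\<close>.\<close>

lemma fourier_injective:
  assumes "\<And>a. fourier G a = 0" "k < n"
  shows "G k = 0"
proof -
  define p where "p = (\<Sum>k<n. monom (G k) k)"
  have "poly p (\<omega> ^ a) = 0" for a
    using assms(1) [of a] by (simp add: p_def poly_sum poly_monom fourier_def power_mult)
  moreover have "degree p < n"
    unfolding p_def using n_gt_1
    by (intro degree_sum_less) (auto intro: le_less_trans [OF degree_monom_le])
  ultimately have "p = 0"
    using root_power_inj
    by (intro poly_eqI_degree [of "(\<lambda>k. \<omega> ^ k) ` {..<n}"]) (auto simp: card_image)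
  then have "coeff p k = 0" by simp
  then show ?thesis using assms(2) by (simp add: p_def coeff_sum)
qed

text \<open>For each prime \<open>q\<close>, one exponent is dropped from every coset of the
  subgroup of order \<open>q\<close>; the vanishing coset sum recovers its power from the
  others.\<close>

definition basis_exponents :: "nat set"
  where "basis_exponents = {k. k < n \<and> (\<forall>q. prime q \<longrightarrow> q dvd n \<longrightarrow> digit n q k \<noteq> 0)}"

lemma finite_basis_exponents: "finite basis_exponents"
  by (simp add: basis_exponents_def)

text \<open>
  Extend the coefficients periodically by zero. By Galois conjugation their Fourier transform
  vanishes at all units modulo \<open>n\<close>; taking differences by \<open>n div q\<close> for every prime \<open>q\<close> kills it at
  the non-units as well, and these differences are injective on the given support.
\<close>
lemma basis_exponents_independent:
  fixes c :: "nat \<Rightarrow> int"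
  assumes "(\<Sum>k\<in>basis_exponents. of_int (c k) * \<omega> ^ k) = 0" and k: "k \<in> basis_exponents"
  shows "c k = 0"
proof -
  define F :: "nat \<Rightarrow> complex"
    where "F k = (if k mod n \<in> basis_exponents then of_int (c (k mod n)) else 0)" for k
  define g where "g = (\<Sum>k\<in>basis_exponents. monom (c k) k)"
  have sub: "basis_exponents \<subseteq> {..<n}" by (auto simp: basis_exponents_def)
  have F_per: "F (k + n) = F k" for k by (simp add: F_def)
  have fourier: "fourier F a = int_poly_eval g (\<omega> ^ a)" for a
    unfolding fourier_def g_def
    by (simp, rule sum.mono_neutral_cong_right) (use sub in \<open>auto simp: F_def power_mult\<close>)
  have g: "int_poly_eval g \<omega> = 0" using assms(1) by (simp add: g_def)
  obtain qs where qs: "set qs = {q. prime q \<and> q dvd n}" "distinct qs"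
    using finite_distinct_list [of "{q. prime q \<and> q dvd n}"] finite_divisors_nat [of n] n_gt_1
    by (metis (no_types, lifting) finite_subset mem_Collect_eq subsetI gr_implies_not0 not_gr_zero)
  define G where "G = foldr (\<lambda>r. shift_diff (n div r)) qs F"
  have "fourier G a = 0" for a
    unfolding G_def
  proof (rule fourier_foldr_shift_diff)
    show "fourier F a = 0 \<or> (\<exists>q\<in>set qs. q dvd a)"
    proof (cases "coprime a n")
      case True
      then show ?thesis by (simp add: fourier int_poly_eval_conjugate [OF g])
    next
      case False
      then obtain q where "prime q" "q dvd gcd a n"
        by (metis coprime_iff_gcd_eq_1 prime_factor_nat)
      then show ?thesis by (auto simp: qs)
    qed
  qed (simp_all add: qs F_per)
  then have "G j = 0" if "j < n" for j
    using fourier_injective that by blast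
  moreover have G_per: "G (j + n) = G j" for j
    unfolding G_def by (rule foldr_shift_diff_periodic) (rule F_per)
  have "G (j + i * n) = G j" for i j
    by (induction i) (use G_per in \<open>simp_all add: add.commute [of n] flip: add.assoc\<close>)
  from this [of "j mod n" "j div n" for j] have "G j = G (j mod n)" for j by simp
  ultimately have G0: "G j = 0" for j using n_gt_1 by simp
  have "F k = 0"
  proof (rule foldr_shift_diff_injective [where n = n and qs = qs])
    fix k q assume q: "q \<in> set qs" "digit n q k = 0"
    then have "digit n q (k mod n) = 0" using n_gt_1 by (simp add: digit_mod qs)
    then show "F k = 0" using q by (auto simp: F_def basis_exponents_def qs)
  qed (use n_gt_1 qs G0 in \<open>auto simp: G_def\<close>)
  then show ?thesis using k sub by (auto simp: F_def)
qed

end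

section \<open>Simultaneous approximation\<close>

context primitive_root_of_unity
begin

text \<open>Each nonzero element of Z[\<omega>] excludes at most one slope \<open>s\<close> for the
  direction 1 + i s, and there are only countably many elements.\<close>

lemma generic_direction:
  obtains Y where "\<And>g. int_poly_eval g \<omega> \<noteq> 0 \<Longrightarrow> Re (Y * int_poly_eval g \<omega>) \<noteq> 0"
proof -
  \<comment> \<open>Coefficient lists form a countable type, and every polynomial \<open>g\<close>
    is \<open>Poly (coeffs g)\<close>.\<close>
  define S where "S = range (\<lambda>xs. Re (int_poly_eval (Poly xs) \<omega>) / Im (int_poly_eval (Poly xs) \<omega>))"
  have "countable S" unfolding S_def by simp
  then obtain s where s: "s \<notin> S"
    using uncountable_UNIV_real by (metis UNIV_eq_I)
  show thesis
  proof
    fix g assume nz: "int_poly_eval g \<omega> \<noteq> 0"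
    show "Re (Complex 1 s * int_poly_eval g \<omega>) \<noteq> 0"
    proof
      assume "Re (Complex 1 s * int_poly_eval g \<omega>) = 0"
      then have eq: "Re (int_poly_eval g \<omega>) = s * Im (int_poly_eval g \<omega>)" by simp
      then have "Im (int_poly_eval g \<omega>) \<noteq> 0" using nz by (auto simp: complex_eq_iff)
      then have "s = Re (int_poly_eval (Poly (coeffs g)) \<omega>) / Im (int_poly_eval (Poly (coeffs g)) \<omega>)"
        using eq by simp
      then show False using s unfolding S_def by blast
    qed
  qed
qed

text \<open>A generic \<open>Y\<close> carries the integral independence of the powers over to the
  reals \<open>Re (Y * \<omega> ^ k)\<close>. Kronecker's theorem then supplies a real
  \<open>t\<close>, and X = t Y.\<close>

lemma basis_exponents_approximation:
  fixes f :: "nat \<Rightarrow> real"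
  assumes "\<delta> > 0"
  shows "\<exists>X. \<forall>k\<in>basis_exponents. \<exists>m::int. \<bar>Re (X * \<omega> ^ k) - of_int m - f k\<bar> < \<delta>"
proof -
  interpret M: Modules.module "\<lambda>r. (*) (real_of_int r)"
    by (simp add: Modules.module.intro distrib_left mult.commute)
  obtain Y where Y: "\<And>g. int_poly_eval g \<omega> \<noteq> 0 \<Longrightarrow> Re (Y * int_poly_eval g \<omega>) \<noteq> 0"
    using generic_direction by blast
  obtain e where e: "bij_betw e {..<card basis_exponents} basis_exponents"
    using ex_bij_betw_nat_finite [OF finite_basis_exponents] by (auto simp: atLeast0LessThan)
  define \<theta> where "\<theta> = (\<lambda>k. Re (Y * \<omega> ^ k))"
  have indep: "c k = 0" if "(\<Sum>k\<in>basis_exponents. of_int (c k) * \<theta> k) = 0" "k \<in> basis_exponents"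
    for c :: "nat \<Rightarrow> int" and k
  proof (rule basis_exponents_independent [OF _ that(2)])
    let ?g = "\<Sum>k\<in>basis_exponents. monom (c k) k"
    have "Re (Y * int_poly_eval ?g \<omega>) = (\<Sum>k\<in>basis_exponents. Re (Y * (of_int (c k) * \<omega> ^ k)))"
      by (simp only: int_poly_eval_sum int_poly_eval_monom sum_distrib_left Re_sum)
    also have "\<dots> = (\<Sum>k\<in>basis_exponents. of_int (c k) * \<theta> k)"
      by (intro sum.cong) (simp_all add: \<theta>_def algebra_simps)
    finally have "int_poly_eval ?g \<omega> = 0" using that(1) Y by metis
    then show "(\<Sum>k\<in>basis_exponents. of_int (c k) * \<omega> ^ k) = 0" by simp
  qed
  have inj: "inj_on \<theta> basis_exponents"
  proof (rule inj_onI, rule ccontr)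
    fix i j assume ij: "i \<in> basis_exponents" "j \<in> basis_exponents" "\<theta> i = \<theta> j" "i \<noteq> j"
    \<comment> \<open>A collision of \<open>\<theta>\<close> at \<open>i\<close> and
      \<open>j\<close> would be an integer relation with coefficients 1 and -1.\<close>
    define c :: "nat \<Rightarrow> int" where "c = (\<lambda>k. (if k = i then 1 else 0) - (if k = j then 1 else 0))"
    have "(\<Sum>k\<in>basis_exponents. of_int (c k) * \<theta> k)
        = (\<Sum>k\<in>basis_exponents. (if k = i then \<theta> k else 0) - (if k = j then \<theta> k else 0))"
      by (intro sum.cong) (auto simp: c_def)
    also have "\<dots> = 0"
      using ij finite_basis_exponents by (simp add: sum_subtractf)
    finally show False using indep [of c i] ij by (simp add: c_def)
  qed
  have img: "(\<theta> \<circ> e) ` {..<card basis_exponents} = \<theta> ` basis_exponents"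
    using e by (simp add: bij_betw_def flip: image_image image_comp)
  have "M.independent (\<theta> ` basis_exponents)"
    unfolding M.independent_explicit_module
  proof (intro allI impI)
    fix T and u :: "real \<Rightarrow> int" and v
    assume T: "finite T" "T \<subseteq> \<theta> ` basis_exponents" "(\<Sum>v\<in>T. of_int (u v) * v) = 0" "v \<in> T"
    define c where "c = (\<lambda>k. if \<theta> k \<in> T then u (\<theta> k) else 0)"
    have "(\<Sum>k\<in>basis_exponents. of_int (c k) * \<theta> k)
        = (\<Sum>x\<in>\<theta> ` basis_exponents. of_int (if x \<in> T then u x else 0) * x)"
      by (simp add: sum.reindex [OF inj] c_def)
    also have "\<dots> = (\<Sum>v\<in>T. of_int (u v) * v)"
      using T finite_basis_exponents by (intro sum.mono_neutral_cong_right) auto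
    finally have "c k = 0" if "k \<in> basis_exponents" for k
      using indep that T(3) by metis
    then show "u v = 0" using T(2,4) by (fastforce simp: c_def)
  qed
  then have "M.independent ((\<theta> \<circ> e) ` {..<card basis_exponents})" unfolding img .
  moreover have "inj_on (\<theta> \<circ> e) {..<card basis_exponents}"
    using e inj by (intro comp_inj_on) (auto simp: bij_betw_def)
  ultimately obtain t h where th:
    "\<And>i. i < card basis_exponents \<Longrightarrow> \<bar>t * (\<theta> \<circ> e) i - of_int (h i) - (f \<circ> e) i\<bar> < \<delta>"
    using Kronecker_thm_1 [of "\<theta> \<circ> e" "card basis_exponents" \<delta> "f \<circ> e"] assms by blast
  show ?thesis
  proof (rule exI, rule ballI)
    fix k assume "k \<in> basis_exponents"
    then obtain i where i: "i < card basis_exponents" "k = e i"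
      using e by (auto simp: bij_betw_def)
    have "Re (of_real t * Y * \<omega> ^ k) = t * \<theta> k" by (simp add: \<theta>_def mult.assoc)
    then show "\<exists>m::int. \<bar>Re (of_real t * Y * \<omega> ^ k) - of_int m - f k\<bar> < \<delta>"
      using th [OF i(1)] i(2) by auto
  qed
qed

section \<open>Spreading the approximation along coset relations\<close>

lemma sum_coset_root_powers:
  assumes "q dvd n" "q > 1"
  shows "(\<Sum>j<q. \<omega> ^ (k + j * (n div q))) = 0"
proof -
  let ?z = "\<omega> ^ (n div q)"
  have "\<not> n dvd n div q"
    using assms n_gt_1 by (auto dest!: dvd_imp_le simp: dvd_def)
  then have "?z \<noteq> 1" by (simp add: root_power_eq_1_iff)
  moreover have "?z ^ q = 1"
    using assms by (simp add: root_power_eq_1_iff flip: power_mult)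
  ultimately have "(\<Sum>j<q. ?z ^ j) = 0"
    by (simp add: geometric_sum)
  then show ?thesis
    by (simp add: power_add mult.commute [of _ "n div q"] power_mult flip: sum_distrib_left)
qed

text \<open>Induction on the number of primes at which \<open>k\<close> has top digit 0. For such a
  prime \<open>q\<close>, the other \<open>q - 1\<close> members of the coset of \<open>k\<close>
  have one zero digit fewer. Over the coset the real parts sum to 0 and \<open>f\<close> sums to an
  integer, so the error at \<open>k\<close> is at most the sum of the other errors, which costs a
  factor below \<open>n\<close>.\<close>

lemma approximation_spreads:
  fixes f :: "nat \<Rightarrow> real"
  assumes per: "\<And>k. f (k mod n) = f k"
    and coset: "\<And>q k. prime q \<Longrightarrow> q dvd n \<Longrightarrow> (\<Sum>j<q. f (k + j * (n div q))) \<in> \<int>"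
    and basis: "\<And>k. k \<in> basis_exponents \<Longrightarrow> \<exists>m::int. \<bar>Re (X * \<omega> ^ k) - of_int m - f k\<bar> \<le> \<eta>"
  shows "\<exists>m::int. \<bar>Re (X * \<omega> ^ k) - of_int m - f k\<bar>
           \<le> real n ^ card {q. prime q \<and> q dvd n \<and> digit n q k = 0} * \<eta>"
proof (induction "card {q. prime q \<and> q dvd n \<and> digit n q k = 0}" arbitrary: k)
  have n0: "n > 0" using n_gt_1 by simp
  have fin: "finite {q. prime q \<and> q dvd n \<and> P q}" for P
    using n_gt_1 by (intro finite_subset [OF _ finite_divisors_nat [of n]]) auto
  {
    case 0
    then have "{q. prime q \<and> q dvd n \<and> digit n q k = 0} = {}"
      using fin by simp
    then have "k mod n \<in> basis_exponents"
      using n0 by (auto simp: basis_exponents_def digit_mod)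
    from basis [OF this] show ?case
      using 0 by (simp add: per root_power_mod)
  next
    case (Suc z)
    let ?Z = "\<lambda>k. {q. prime q \<and> q dvd n \<and> digit n q k = 0}"
    have "?Z k \<noteq> {}" using Suc.hyps(2) by (metis card.empty nat.distinct(1))
    then obtain q where q: "prime q" "q dvd n" "digit n q k = 0" by blast
    have q1: "q > 1" using q(1) by (rule prime_gt_1_nat)
    have inj: "inj_on (\<lambda>j. digit n q (k + j * (n div q))) {..<q}"
      using digit_bij_betw_coset [OF n0 q(1,2)] by (simp add: bij_betw_def)
    have "\<exists>m::int. \<bar>Re (X * \<omega> ^ (k + j * (n div q))) - of_int m - f (k + j * (n div q))\<bar>
        \<le> real n ^ z * \<eta>" if j: "j \<in> {1..<q}" for j
    proof -
      have "digit n q (k + j * (n div q)) \<noteq> digit n q (k + 0 * (n div q))"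
        using inj_onD [OF inj, of j 0] j by auto
      then have "?Z (k + j * (n div q)) = ?Z k - {q}"
        using q digit_other_coset [OF n0 _ _ q(1,2), of _ k j] by (intro set_eqI) (auto, metis+)
      then have "z = card (?Z (k + j * (n div q)))"
        using Suc.hyps(2) q by simp
      from Suc.hyps(1) [OF this] this show ?thesis by metis
    qed
    then obtain m :: "nat \<Rightarrow> int" where m: "\<And>j. j \<in> {1..<q} \<Longrightarrow>
        \<bar>Re (X * \<omega> ^ (k + j * (n div q))) - of_int (m j) - f (k + j * (n div q))\<bar> \<le> real n ^ z * \<eta>"
      by metis
    obtain S :: int where S: "(\<Sum>j<q. f (k + j * (n div q))) = of_int S"
      using coset [OF q(1,2)] by (auto elim: Ints_cases)
    have split: "(\<Sum>j<q. h j) = h 0 + (\<Sum>j\<in>{1..<q}. h j)" for h :: "nat \<Rightarrow> real"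
      using q1 by (simp add: lessThan_atLeast0 sum.atLeast_Suc_lessThan)
    have "(\<Sum>j<q. Re (X * \<omega> ^ (k + j * (n div q)))) = Re (X * (\<Sum>j<q. \<omega> ^ (k + j * (n div q))))"
      by (simp only: sum_distrib_left Re_sum)
    then have Re0: "(\<Sum>j<q. Re (X * \<omega> ^ (k + j * (n div q)))) = 0"
      using sum_coset_root_powers [OF q(2) q1] by simp
    \<comment> \<open>The integer for \<open>k\<close> is forced by the coset: the
      \<open>m j\<close> together with it must sum to \<open>- S\<close>.\<close>
    have "Re (X * \<omega> ^ k) - of_int (- S - (\<Sum>j\<in>{1..<q}. m j)) - f k
      = - (\<Sum>j\<in>{1..<q}. Re (X * \<omega> ^ (k + j * (n div q))) - of_int (m j) - f (k + j * (n div q)))"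
      using Re0 S unfolding split by (simp add: sum_subtractf)
    also have "\<bar>\<dots>\<bar> \<le> (\<Sum>j\<in>{1..<q}. real n ^ z * \<eta>)"
      unfolding abs_minus_cancel using m by (intro sum_abs [THEN order_trans] sum_mono)
    also have "\<dots> = (real q - 1) * (real n ^ z * \<eta>)" using q1 by (simp add: of_nat_diff)
    also have "\<dots> \<le> real n * (real n ^ z * \<eta>)"
    proof (rule mult_right_mono)
      show "real q - 1 \<le> real n" using dvd_imp_le [OF q(2) n0] by simp
      show "0 \<le> real n ^ z * \<eta>" using m [of 1] q1 by force
    qed
    finally show ?case
      unfolding Suc.hyps(2) [symmetric] power_Suc mult.assoc by blast
  }
qed

lemma simultaneous_approximation:
  fixes f :: "nat \<Rightarrow> real"
  assumes per: "\<And>k. f (k mod n) = f k"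
    and coset: "\<And>q k. prime q \<Longrightarrow> q dvd n \<Longrightarrow> (\<Sum>j<q. f (k + j * (n div q))) \<in> \<int>"
    and "\<delta> > 0"
  shows "\<exists>X. \<forall>k. \<exists>m::int. \<bar>Re (X * \<omega> ^ k) - of_int m - f k\<bar> < \<delta>"
proof -
  define P where "P = {q. prime q \<and> q dvd n}"
  \<comment> \<open>Every prime divisor may cost a factor \<open>n\<close>; the 2 makes the final
    inequality strict.\<close>
  define \<eta> where "\<eta> = \<delta> / (2 * real n ^ card P)"
  have fin: "finite P"
    unfolding P_def using n_gt_1 by (intro finite_subset [OF _ finite_divisors_nat [of n]]) auto
  have \<eta>: "\<eta> > 0" using assms n_gt_1 by (simp add: \<eta>_def)
  then obtain X where X: "\<forall>k\<in>basis_exponents. \<exists>m::int. \<bar>Re (X * \<omega> ^ k) - of_int m - f k\<bar> < \<eta>"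
    using basis_exponents_approximation by blast
  have "\<exists>m::int. \<bar>Re (X * \<omega> ^ k) - of_int m - f k\<bar> < \<delta>" for k
  proof -
    let ?Z = "{q. prime q \<and> q dvd n \<and> digit n q k = 0}"
    have "\<exists>m::int. \<bar>Re (X * \<omega> ^ k) - of_int m - f k\<bar> \<le> real n ^ card ?Z * \<eta>"
      using X by (intro approximation_spreads per coset) (auto intro: less_imp_le)
    moreover have "card ?Z \<le> card P" using fin by (intro card_mono) (auto simp: P_def)
    then have "real n ^ card ?Z * \<eta> \<le> real n ^ card P * \<eta>"
      using n_gt_1 \<eta> by (intro mult_right_mono power_increasing) auto
    moreover have "real n ^ card P * \<eta> < \<delta>" using assms n_gt_1 by (simp add: \<eta>_def)
    ultimately show ?thesis by (meson le_less_trans)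
  qed
  then show ?thesis by blast
qed

text \<open>An error below \<open>l - \<epsilon>\<close> keeps the approximated value inside the
  open interval; as this lies in (0, 1), the value is its own fractional part.\<close>

lemma frac_in_interval_if_coset_sums:
  fixes f :: "nat \<Rightarrow> real"
  assumes "\<And>k. f (k mod n) = f k"
    and "\<And>q k. prime q \<Longrightarrow> q dvd n \<Longrightarrow> (\<Sum>j<q. f (k + j * (n div q))) \<in> \<int>"
    and f: "\<And>k. f k \<in> {l..1 - l}" and \<epsilon>: "0 < \<epsilon>" "\<epsilon> < l"
  shows "\<exists>X. \<forall>k. frac (Re (X * \<omega> ^ k)) \<in> {\<epsilon><..<1 - \<epsilon>}"
proof -
  obtain X where X: "\<forall>k. \<exists>m::int. \<bar>Re (X * \<omega> ^ k) - of_int m - f k\<bar> < l - \<epsilon>"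
    using simultaneous_approximation [of f "l - \<epsilon>"] assms by auto
  have "frac (Re (X * \<omega> ^ k)) \<in> {\<epsilon><..<1 - \<epsilon>}" for k
  proof -
    obtain m :: int where m: "\<bar>Re (X * \<omega> ^ k) - of_int m - f k\<bar> < l - \<epsilon>" using X by blast
    then have in_int: "Re (X * \<omega> ^ k) - of_int m \<in> {\<epsilon><..<1 - \<epsilon>}"
      using f [of k] by (auto simp: abs_less_iff)
    then have "frac (Re (X * \<omega> ^ k)) = Re (X * \<omega> ^ k) - of_int m"
      using \<epsilon> by (subst frac_unique_iff) auto
    then show ?thesis using in_int by simp
  qed
  then show ?thesis by blast
qed

section \<open>The upper bound on \<open>\<epsilon>\<close>\<close>

lemma epsilon_less_if_frac_in_interval:
  assumes p: "odd p" "p > 1" "p dvd n"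
    and X: "\<And>k. k \<in> {1..n} \<Longrightarrow> frac (Re (X * \<omega> ^ k)) \<in> {\<epsilon><..<1 - \<epsilon>}"
  shows "\<epsilon> < (real p - 1) / (2 * real p)"
proof -
  \<comment> \<open>The coset starts at \<open>n div p\<close> instead of 0, so that its exponents
    lie between 1 and \<open>n\<close>.\<close>
  define x where "x j = Re (X * \<omega> ^ (n div p + j * (n div p)))" for j
  have x: "frac (x j) \<in> {\<epsilon><..<1 - \<epsilon>}" if "j < p" for j
    unfolding x_def
  proof (rule X)
    have "Suc j * (n div p) \<le> p * (n div p)" using that by (intro mult_right_mono) auto
    moreover have "n div p > 0" using p n_gt_1 by (simp add: div_greater_zero_iff dvd_imp_le)
    ultimately show "n div p + j * (n div p) \<in> {1..n}" using p(3) by simp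
  qed
  define S where "S = - (\<Sum>j<p. \<lfloor>x j\<rfloor>)"
  have "(\<Sum>j<p. x j) = Re (X * (\<Sum>j<p. \<omega> ^ (n div p + j * (n div p))))"
    by (simp only: x_def sum_distrib_left Re_sum)
  then have "(\<Sum>j<p. x j) = 0" using sum_coset_root_powers [OF p(3,2)] by simp
  then have S: "(\<Sum>j<p. frac (x j)) = of_int S"
    by (simp add: frac_def sum_subtractf S_def)
  have ne: "{..<p} \<noteq> {}" using p(2) by auto
  have "(\<Sum>j<p. \<epsilon>) < (\<Sum>j<p. frac (x j))" "(\<Sum>j<p. frac (x j)) < (\<Sum>j<p. 1 - \<epsilon>)"
    by (rule sum_strict_mono; use x ne in auto)+
  then have bounds: "real p * \<epsilon> < of_int S" "of_int S < real p * (1 - \<epsilon>)"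
    using S by simp_all
  \<comment> \<open>No integer lies strictly between \<open>h\<close> and \<open>h + 1\<close>, so
    \<open>S\<close> is at distance at least 1/2 from p/2; either side gives the same bound.\<close>
  obtain h where h: "p = 2 * h + 1" using p(1) by (rule oddE)
  have "real p * \<epsilon> < real h"
  proof (cases "S \<le> int h")
    case True
    then have "of_int S \<le> real h" by linarith
    then show ?thesis using bounds(1) by linarith
  next
    case False
    then have "of_int S \<ge> real h + 1" by linarith
    then show ?thesis using bounds(2) h by (simp add: algebra_simps)
  qed
  then show ?thesis using h by (simp add: field_simps)
qed

end

section \<open>Sign patterns with prescribed coset sums\<close>

text \<open>For odd \<open>q\<close>, the threshold \<open>(q + p) div 2\<close> is what makes the signs sum to \<open>p\<close>.\<close>
definition coset_sign :: "nat \<Rightarrow> nat \<Rightarrow> nat \<Rightarrow> real"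
  where "coset_sign p q d = (if d < (if q = 2 then 1 else (q + p) div 2) then 1 else - 1)"

lemma sum_coset_sign:
  assumes "q = 2 \<or> odd q \<and> p \<le> q" "odd p"
  shows "(\<Sum>d<q. coset_sign p q d) = (if q = 2 then 0 else real p)"
proof (cases "q = 2")
  case True
  then show ?thesis by (simp add: coset_sign_def numeral_2_eq_2)
next
  case False
  let ?m = "(q + p) div 2"
  have m: "?m \<le> q" "2 * real ?m = real q + real p"
    using assms False by (auto elim!: oddE)
  have "(\<Sum>d<q. coset_sign p q d) = (\<Sum>d\<in>{..<?m} \<union> {?m..<q}. coset_sign p q d)"
    using m(1) by (intro sum.cong) auto
  also have "\<dots> = (\<Sum>d<?m. coset_sign p q d) + (\<Sum>d\<in>{?m..<q}. coset_sign p q d)"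
    by (intro sum.union_disjoint) auto
  also have "\<dots> = real ?m - (real q - real ?m)"
    using m(1) False by (simp add: coset_sign_def of_nat_diff)
  also have "\<dots> = real p" using m(2) by simp
  finally show ?thesis using False by simp
qed

text \<open>Along a coset for \<open>q\<close> only the digit at \<open>q\<close> moves, and it
  takes each value once. The sum therefore factors into a fixed sign from the other primes and the
  full sum of \<open>coset_sign p q\<close>.\<close>

lemma balanced_signs_exist:
  assumes n: "n > 0" and p: "odd p" and least: "\<And>q. prime q \<Longrightarrow> odd q \<Longrightarrow> q dvd n \<Longrightarrow> p \<le> q"
  obtains s :: "nat \<Rightarrow> real" where "\<And>k. s k \<in> {-1, 1}" "\<And>k. s (k mod n) = s k"
    and "\<And>q k. prime q \<Longrightarrow> q dvd n \<Longrightarrow>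
      (\<Sum>j<q. s (k + j * (n div q))) \<in> (if q = 2 then {0} else {real p, - real p})"
proof -
  define P where "P = {q. prime q \<and> q dvd n}"
  define s where "s k = (\<Prod>q\<in>P. coset_sign p q (digit n q k))" for k
  have fin: "finite P"
    unfolding P_def using n by (intro finite_subset [OF _ finite_divisors_nat [of n]]) auto
  have sign: "(\<Prod>q\<in>Q. coset_sign p q (d q)) \<in> {-1, 1}" for Q d
    by (induction Q rule: infinite_finite_induct) (auto simp: coset_sign_def)
  show thesis
  proof
    show "s k \<in> {-1, 1}" for k unfolding s_def by (rule sign)
    show "s (k mod n) = s k" for k
      unfolding s_def using n by (intro prod.cong) (simp_all add: digit_mod P_def)
    fix q k assume q: "prime q" "q dvd n"
    define c where "c = (\<Prod>r\<in>P - {q}. coset_sign p r (digit n r k))"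
    have "s (k + j * (n div q)) = coset_sign p q (digit n q (k + j * (n div q))) * c" for j
    proof -
      have "s (k + j * (n div q)) = coset_sign p q (digit n q (k + j * (n div q))) *
          (\<Prod>r\<in>P - {q}. coset_sign p r (digit n r (k + j * (n div q))))"
        unfolding s_def using fin q by (intro prod.remove) (auto simp: P_def)
      also have "(\<Prod>r\<in>P - {q}. coset_sign p r (digit n r (k + j * (n div q)))) = c"
        unfolding c_def using digit_other_coset [OF n _ _ q] by (intro prod.cong) (auto simp: P_def)
      finally show ?thesis .
    qed
    then have "(\<Sum>j<q. s (k + j * (n div q)))
        = (\<Sum>j<q. coset_sign p q (digit n q (k + j * (n div q)))) * c"
      by (simp add: sum_distrib_right)
    also have "(\<Sum>j<q. coset_sign p q (digit n q (k + j * (n div q)))) = (\<Sum>d<q. coset_sign p q d)"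
      by (rule sum.reindex_bij_betw [OF digit_bij_betw_coset [OF n q]])
    also have "\<dots> = (if q = 2 then 0 else real p)"
      using q p least [of q] prime_odd_nat [of q] prime_ge_2_nat [of q]
      by (intro sum_coset_sign) (auto simp: le_less)
    finally show "(\<Sum>j<q. s (k + j * (n div q))) \<in> (if q = 2 then {0} else {real p, - real p})"
      using sign [of "\<lambda>r. digit n r k" "P - {q}"] by (auto simp: c_def)
  qed
qed

section \<open>The equivalence\<close>

lemma power_of_2_if_no_odd_prime_divisor:
  fixes n :: nat
  assumes "n > 0" "\<And>p. prime p \<Longrightarrow> odd p \<Longrightarrow> \<not> p dvd n"
  shows "\<exists>m. n = 2 ^ m"
proof -
  obtain m where m: "n = 2 ^ multiplicity 2 n * m" "\<not> 2 dvd m"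
    using multiplicity_decompose' [of n 2] assms(1) by auto
  have "m = 1"
  proof (rule ccontr)
    assume "m \<noteq> 1"
    then obtain p where "prime p" "p dvd m" using prime_factor_nat by blast
    then show False using m assms(2) [of p] by (metis dvd_mult dvd_trans)
  qed
  then show ?thesis using m(1) by auto
qed

theorem theorem1p1:
  fixes n :: nat and \<omega> :: complex and \<epsilon> :: real
  assumes "n > 1"
    and "\<omega> = exp (2 * of_real pi * \<i> / of_nat n)"
    and "\<epsilon> > 0"
  shows "(\<exists>X::complex. \<forall>k\<in>{1..n}. frac (Re (X * \<omega> ^ k)) \<in> {\<epsilon><..<1 - \<epsilon>}) \<longleftrightarrow>
    (if \<not> (\<exists>m::nat. n = 2 ^ m)
     then let p = (LEAST p::nat. prime p \<and> odd p \<and> p dvd n)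
          in \<epsilon> < (real p - 1) / (2 * real p)
     else \<epsilon> < 1 / 2)"
proof -
  interpret primitive_root_of_unity n \<omega>
  proof
    show "\<omega> ^ k = 1 \<longleftrightarrow> n dvd k" for k
      using complex_root_unity_eq_1 [of n k] assms(1,2)
      by (simp add: exp_of_nat_mult [symmetric] mult_ac)
  qed (fact assms(1))
  show ?thesis (is "?lhs \<longleftrightarrow> _")
  proof (cases "\<exists>m. n = 2 ^ m")
    case True
    then obtain m where m: "n = 2 ^ m" by blast
    have q2: "q = 2" if "prime q" "q dvd n" for q
    proof -
      have "q dvd 2" using that prime_dvd_power [of q 2 m] by (simp add: m)
      then show ?thesis using that(1) by (simp add: primes_dvd_imp_eq)
    qed
    have "\<epsilon> < 1 / 2" if lhs: ?lhs
    proof -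
      obtain X where "\<forall>k\<in>{1..n}. frac (Re (X * \<omega> ^ k)) \<in> {\<epsilon><..<1 - \<epsilon>}"
        using lhs by (rule exE)
      then have "frac (Re (X * \<omega> ^ 1)) \<in> {\<epsilon><..<1 - \<epsilon>}"
        by (rule bspec) (use assms(1) in simp)
      then show ?thesis by auto
    qed
    moreover have ?lhs if \<epsilon>: "\<epsilon> < 1 / 2"
    proof -
      have "\<exists>X. \<forall>k. frac (Re (X * \<omega> ^ k)) \<in> {\<epsilon><..<1 - \<epsilon>}"
        using \<epsilon> assms(3)
        \<comment> \<open>The only prime divisor is 2, so the constant 1/2 has coset sums equal to
          1.\<close>
        by (intro frac_in_interval_if_coset_sums [of "\<lambda>_. 1 / 2" "1 / 2"]) (auto dest: q2)
      then show ?thesis by blast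
    qed
    ultimately show ?thesis using True by auto
  next
    case False
    define p where "p = (LEAST p::nat. prime p \<and> odd p \<and> p dvd n)"
    have "\<exists>p. prime p \<and> odd p \<and> p dvd n"
      using power_of_2_if_no_odd_prime_divisor False assms(1) by (metis gr0I not_less_zero)
    then have p: "prime p" "odd p" "p dvd n"
      unfolding p_def by (metis (mono_tags, lifting) LeastI)+
    have least: "p \<le> q" if "prime q" "odd q" "q dvd n" for q
      unfolding p_def using that by (intro Least_le) simp
    have n0: "n > 0" using assms(1) by simp
    have p1: "p > 1" using p(1) by (rule prime_gt_1_nat)
    have "\<epsilon> < (real p - 1) / (2 * real p)" if ?lhs
      using that epsilon_less_if_frac_in_interval [OF p(2) p1 p(3)] by blast
    moreover have ?lhs if \<epsilon>: "\<epsilon> < (real p - 1) / (2 * real p)"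
    proof (rule balanced_signs_exist [OF n0 p(2)])
      show "p \<le> q" if "prime q" "odd q" "q dvd n" for q
        using that by (rule least)
    next
      fix s :: "nat \<Rightarrow> real"
      assume s: "\<And>k. s k \<in> {-1, 1}" "\<And>k. s (k mod n) = s k"
        "\<And>q k. prime q \<Longrightarrow> q dvd n \<Longrightarrow>
          (\<Sum>j<q. s (k + j * (n div q))) \<in> (if q = 2 then {0} else {real p, - real p})"
      have "\<exists>X. \<forall>k. frac (Re (X * \<omega> ^ k)) \<in> {\<epsilon><..<1 - \<epsilon>}"
      \<comment> \<open>Values at distance 1/(2p) from 1/2 are exactly the endpoints of the target
        interval. Their coset sums are 1 for \<open>q = 2\<close> and q/2 plus or minus 1/2 for odd
        \<open>q\<close>.\<close>
      proof (rule frac_in_interval_if_coset_sums [of "\<lambda>k. 1 / 2 + s k / (2 * real p)"])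
        show "1 / 2 + s (k mod n) / (2 * real p) = 1 / 2 + s k / (2 * real p)" for k
          by (simp add: s)
        show "1 / 2 + s k / (2 * real p)
            \<in> {(real p - 1) / (2 * real p)..1 - (real p - 1) / (2 * real p)}" for k
          using s(1) [of k] p1 by (auto simp: field_simps)
        fix q k assume q: "prime q" "q dvd n"
        have eq: "(\<Sum>j<q. 1 / 2 + s (k + j * (n div q)) / (2 * real p))
            = real q / 2 + (\<Sum>j<q. s (k + j * (n div q))) / (2 * real p)"
          by (simp add: sum.distrib sum_divide_distrib)
        show "(\<Sum>j<q. 1 / 2 + s (k + j * (n div q)) / (2 * real p)) \<in> \<int>"
        proof (cases "q = 2")
          case True
          then show ?thesis unfolding eq using s(3) [OF q, of k] by simp
        next
          case False
          then have "odd q" using q(1) prime_odd_nat [of q] prime_ge_2_nat [of q] by simp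
          then obtain h where h: "q = 2 * h + 1" by (rule oddE)
          have "(\<Sum>j<q. s (k + j * (n div q))) / (2 * real p) \<in> {1 / 2, - 1 / 2}"
            using s(3) [OF q, of k] False p1 by auto
          moreover have "real q / 2 + x \<in> \<int>" if "x \<in> {1 / 2, - 1 / 2}" for x :: real
          proof -
            have "real q / 2 + x \<in> {real h + 1, real h}" using that h by (auto simp: field_simps)
            then show ?thesis by auto
          qed
          ultimately show ?thesis unfolding eq by blast
        qed
      qed (use \<epsilon> assms(3) in auto)
      then show ?lhs by blast
    qed
    ultimately show ?thesis using False by (auto simp: Let_def simp flip: p_def)
  qed
qed

end
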